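(* Let $\mathcal H$ be a real Hilbert space, $N\ge1$, and $C_1,\dots,C_N\subseteq\mathcal H$ closed convex subsets with $C:=\bigcap_{i=1}^N C_i\neq\emptyset$. Let $x_0\in\mathcal H$ and let $(x_n),(q_n)$ be the sequences generated by Dykstra's cyclic projection algorithm for $C_1,\dots,C_N$ with starting point $x_0$. Let $z\in C$ and let $b>0$ be a natural number with $\|z-x_0\|\le b$. For $n,r\in\mathbb N$ let $S(n,r)$ be the property $$\sum_{k=n-N+1}^{n}\langle x_k-x_n,q_k\rangle<\frac1{r+1},$$ and put $G(a):=H(a):=a^2$ and $\rho(r):=8b(r+1)-1$. Then $(x_n)$ is uniformly locally $S$-relativized $(G,H)$-Fejér monotone w.r.t. $C$ with modulus $\rho$, i.e. for all $p\in C$ and all $r,n\in\mathbb N$: if $\|x_n-p\|<\frac1{\rho(r)+1}$ and $S(n,\rho(r))$, then $\|x_{n+l}-p\|^2\le\|x_n-p\|^2+\frac1{r+1}$ for all $l\in\mathbb N$.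
   Context: $\mathbb N=\{0,1,2,\dots\}$. Dykstra's algorithm: let $P_i$ be the metric projection of $\mathcal H$ onto $C_i$ for $i=1,\dots,N$, and for $n\ge1$ let $P_n:=P_j$ where $j\in\{1,\dots,N\}$ and $j\equiv n \pmod N$. Put $q_{-(N-1)}=\dots=q_{-1}=q_0:=0$ and, for $n\ge1$, $$x_n:=P_n(x_{n-1}+q_{n-N}),\qquad q_n:=x_{n-1}+q_{n-N}-x_n.$$ For negative indices $k$, $x_k$ denotes an arbitrary point of $\mathcal H$ (this plays no role, since $q_k=0$ there). *)

theory Defs
  imports "HOL-Analysis.Analysis" "HOL-Number_Theory.Cong"
begin

text \<open>
  The library's \<open>closest_point\<close> is restricted to class \<open>heine_borel\<close>, i.e. to finite dimension.
\<close>

definition metric_proj :: "'a::real_inner set \<Rightarrow> 'a \<Rightarrow> 'a" where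
  "metric_proj S a = (THE y. y \<in> S \<and> (\<forall>w\<in>S. norm (a - y) \<le> norm (a - w)))"

text \<open>
  Both sequences are indexed by integers, since the recursion refers to \<open>q\<close> at
  \<open>-(N-1), \<dots>, 0\<close>.  The values of \<open>x\<close> at negative indices are unconstrained.
  For every \<open>n\<close> exactly one \<open>j\<close> in \<open>{1..N}\<close> is congruent to \<open>n\<close> modulo \<open>N\<close>.
\<close>

definition dykstra ::
  "nat \<Rightarrow> (nat \<Rightarrow> 'a set) \<Rightarrow> 'a \<Rightarrow> (int \<Rightarrow> 'a) \<Rightarrow> (int \<Rightarrow> 'a::real_inner) \<Rightarrow> bool" where
  "dykstra N C x0 x q \<longleftrightarrow>
     x 0 = x0 \<and>
     (\<forall>k\<in>{- (int N - 1)..0}. q k = 0) \<and>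
     (\<forall>n\<ge>1. \<forall>j\<in>{1..N}. [int j = n] (mod int N) \<longrightarrow>
        x n = metric_proj (C j) (x (n - 1) + q (n - int N))) \<and>
     (\<forall>n\<ge>1. q n = x (n - 1) + q (n - int N) - x n)"

definition dykstra_S :: "nat \<Rightarrow> (int \<Rightarrow> 'a) \<Rightarrow> (int \<Rightarrow> 'a::real_inner) \<Rightarrow> nat \<Rightarrow> nat \<Rightarrow> bool" where
  "dykstra_S N x q n r \<longleftrightarrow>
     (\<Sum>k = int n - int N + 1..int n. (x k - x (int n)) \<bullet> q k) < 1 / (real r + 1)"

definition uniformly_locally_relativized_fejer ::
  "(nat \<Rightarrow> nat \<Rightarrow> bool) \<Rightarrow> (real \<Rightarrow> real) \<Rightarrow> (real \<Rightarrow> real) \<Rightarrow>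
   (nat \<Rightarrow> 'a::real_inner) \<Rightarrow> 'a set \<Rightarrow> (nat \<Rightarrow> nat) \<Rightarrow> bool" where
  "uniformly_locally_relativized_fejer S G H x C \<rho> \<longleftrightarrow>
     (\<forall>p\<in>C. \<forall>r n. norm (x n - p) < 1 / (real (\<rho> r) + 1) \<and> S n (\<rho> r) \<longrightarrow>
        (\<forall>l. H (norm (x (n + l) - p)) \<le> G (norm (x n - p)) + 1 / (real r + 1)))"

end

theory Submission
  imports Defs
begin

text \<open>
  Fix \<open>p\<close> in the intersection.  The energy
  \<open>\<parallel>x\<^sub>n - p\<parallel>\<^sup>2 + 2 \<Sum>\<^bsub>k=n-N+1\<^esub>\<^bsup>n\<^esup> \<langle>x\<^sub>k - p, q\<^sub>k\<rangle>\<close> is nonincreasing in \<open>n\<close>: one step lowers it by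
  \<open>\<parallel>x\<^sub>n - x\<^sub>n\<^sub>-\<^sub>1\<parallel>\<^sup>2 + 2 \<langle>x\<^sub>n\<^sub>-\<^sub>N - x\<^sub>n, q\<^sub>n\<^sub>-\<^sub>N\<rangle>\<close>, and both terms are nonnegative because \<open>q\<^sub>k\<close> is normal
  to \<open>C\<^sub>k\<close> at \<open>x\<^sub>k\<close>; for the same reason the sum in the energy is nonnegative.  Starting from
  index \<open>0\<close> this gives \<open>\<parallel>x\<^sub>n - z\<parallel> \<le> \<parallel>x\<^sub>0 - z\<parallel>\<close>.  Starting from index \<open>n\<close>, the excess over
  \<open>\<parallel>x\<^sub>n - p\<parallel>\<^sup>2\<close> is twice
  \<open>\<Sum>\<langle>x\<^sub>k - x\<^sub>n, q\<^sub>k\<rangle> + \<langle>x\<^sub>n - p, x\<^sub>0 - x\<^sub>n\<rangle>\<close>, since the last \<open>N\<close> of the \<open>q\<^sub>k\<close> telescope to \<open>x\<^sub>0 - x\<^sub>n\<close>.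
\<close>

section \<open>Metric projections in Hilbert space\<close>

text \<open>Parallelogram law for \<open>a - u\<close> and \<open>a - v\<close>: by convexity the
  midpoint of \<open>u\<close> and \<open>v\<close> lies in \<open>S\<close>, so its distance to
  \<open>a\<close> is at least \<open>d\<close>.\<close>

lemma norm_diff_sq_le_near_minimizers:
  fixes S :: "'a::real_inner set"
  assumes "convex S" "u \<in> S" "v \<in> S" "0 \<le> d" "\<And>w. w \<in> S \<Longrightarrow> d \<le> norm (a - w)"
  shows "(norm (u - v))\<^sup>2 \<le> 2 * (norm (a - u))\<^sup>2 + 2 * (norm (a - v))\<^sup>2 - 4 * d\<^sup>2"
proof -
  let ?m = "(1/2) *\<^sub>R u + (1/2) *\<^sub>R v"
  have "?m \<in> S"
    using assms(1-3) by (auto intro: convexD)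
  then have "d\<^sup>2 \<le> (norm (a - ?m))\<^sup>2"
    using assms(4,5) by (intro power_mono) auto
  moreover have "(norm (u - v))\<^sup>2 + 4 * (norm (a - ?m))\<^sup>2
      = 2 * (norm (a - u))\<^sup>2 + 2 * (norm (a - v))\<^sup>2"
    unfolding power2_norm_eq_inner
    by (simp add: algebra_simps inner_commute)
  ultimately show ?thesis
    by linarith
qed

text \<open>Completeness replaces compactness: the preceding bound makes a minimizing sequence
  Cauchy.\<close>

lemma ex1_metric_projection:
  fixes S :: "'a::{real_inner, complete_space} set"
  assumes "convex S" "closed S" "S \<noteq> {}"
  shows "\<exists>!y. y \<in> S \<and> (\<forall>w\<in>S. norm (a - y) \<le> norm (a - w))"
proof -
  define d where "d = infdist a S"
  have d0: "0 \<le> d"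
    by (simp add: d_def infdist_nonneg)
  have d_le: "d \<le> norm (a - w)" if "w \<in> S" for w
    using infdist_le[OF that, of a] by (simp add: d_def dist_norm)
  have "\<exists>y\<in>S. norm (a - y) < d + 1 / (real n + 1)" for n
  proof (rule ccontr)
    assume "\<not> ?thesis"
    then have "d + 1 / (real n + 1) \<le> infdist a S"
      using \<open>S \<noteq> {}\<close> by (auto simp: infdist_notempty dist_norm not_less intro: cINF_greatest)
    then show False
      by (simp add: d_def)
  qed
  then obtain y where yS: "\<And>n. y n \<in> S" and y: "\<And>n. norm (a - y n) < d + 1 / (real n + 1)"
    by metis
  have ylim: "(\<lambda>n. norm (a - y n)) \<longlonglongrightarrow> d"
  proof (rule tendsto_sandwich[OF _ _ tendsto_const])
    show "(\<lambda>n. d + 1 / (real n + 1)) \<longlonglongrightarrow> d"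
      using tendsto_add[OF tendsto_const LIMSEQ_inverse_real_of_nat, of d]
      by (simp add: inverse_eq_divide add.commute)
  qed (use yS d_le less_imp_le[OF y] in auto)
  have "(\<lambda>n. 4 * (norm (a - y n))\<^sup>2 - 4 * d\<^sup>2) \<longlonglongrightarrow> 4 * d\<^sup>2 - 4 * d\<^sup>2"
    by (intro tendsto_intros ylim)
  then have lim: "(\<lambda>n. 4 * (norm (a - y n))\<^sup>2 - 4 * d\<^sup>2) \<longlonglongrightarrow> 0"
    by simp
  have "Cauchy y"
  proof (rule CauchyI)
    fix e :: real assume "0 < e"
    then have "\<forall>\<^sub>F n in sequentially. 4 * (norm (a - y n))\<^sup>2 - 4 * d\<^sup>2 < e\<^sup>2"
      by (intro order_tendstoD(2)[OF lim]) simp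
    then obtain M where M: "\<And>n. n \<ge> M \<Longrightarrow> 4 * (norm (a - y n))\<^sup>2 - 4 * d\<^sup>2 < e\<^sup>2"
      by (auto simp: eventually_sequentially)
    have "norm (y m - y n) < e" if "m \<ge> M" "n \<ge> M" for m n
    proof (rule power2_less_imp_less)
      show "(norm (y m - y n))\<^sup>2 < e\<^sup>2"
        using norm_diff_sq_le_near_minimizers[OF \<open>convex S\<close> yS yS d0 d_le, of m n]
          M[OF that(1)] M[OF that(2)] by linarith
    qed (use \<open>0 < e\<close> in simp)
    then show "\<exists>M. \<forall>m\<ge>M. \<forall>n\<ge>M. norm (y m - y n) < e"
      by blast
  qed
  then obtain l where l: "y \<longlonglongrightarrow> l"
    using Cauchy_convergent convergent_def by blast
  have "l \<in> S"
    using closed_sequentially[OF \<open>closed S\<close>] yS l by blast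
  have "norm (a - l) = d"
    by (rule LIMSEQ_unique[OF tendsto_norm[OF tendsto_diff[OF tendsto_const l]] ylim])
  show ?thesis
  proof (rule ex1I)
    show "l \<in> S \<and> (\<forall>w\<in>S. norm (a - l) \<le> norm (a - w))"
      using \<open>l \<in> S\<close> \<open>norm (a - l) = d\<close> d_le by auto
  next
    fix v assume "v \<in> S \<and> (\<forall>w\<in>S. norm (a - v) \<le> norm (a - w))"
    then show "v = l"
      using any_closest_point_unique[OF assms(1,2) _ \<open>l \<in> S\<close>, where a = a]
        \<open>norm (a - l) = d\<close> d_le by (simp add: dist_norm)
  qed
qed

lemma
  fixes S :: "'a::{real_inner, complete_space} set"
  assumes "convex S" "closed S" "S \<noteq> {}"
  shows metric_proj_in: "metric_proj S a \<in> S"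
    and metric_proj_le: "w \<in> S \<Longrightarrow> norm (a - metric_proj S a) \<le> norm (a - w)"
  using theI'[OF ex1_metric_projection[OF assms, of a]] by (auto simp: metric_proj_def)

text \<open>The variational inequality of the projection, with signs arranged so that the residual
  is a normal vector at the projected point.\<close>

lemma metric_proj_dot:
  fixes S :: "'a::{real_inner, complete_space} set"
  assumes "convex S" "closed S" "w \<in> S"
  shows "(metric_proj S a - w) \<bullet> (a - metric_proj S a) \<ge> 0"
proof -
  have "S \<noteq> {}"
    using assms(3) by blast
  note proj = metric_proj_in[OF assms(1,2) this, of a] metric_proj_le[OF assms(1,2) this, of _ a]
  have "(a - metric_proj S a) \<bullet> (w - metric_proj S a) \<le> 0"
    using proj by (intro any_closest_point_dot[OF assms(1,2) _ assms(3)]) (auto simp: dist_norm)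
  then show ?thesis
    by (simp add: inner_diff inner_commute)
qed

text \<open>Both windows arise from \<open>{n - int N..n}\<close> by dropping one endpoint.\<close>

lemma sum_int_interval_shift:
  fixes f :: "int \<Rightarrow> 'b::ab_group_add"
  assumes "N \<ge> (1::nat)"
  shows "sum f {n - int N + 1..n} = sum f {n - int N..n - 1} + f n - f (n - int N)"
proof -
  have "{n - int N..n} = insert n {n - int N..n - 1}"
    "{n - int N..n} = insert (n - int N) {n - int N + 1..n}"
    using assms by auto
  then have "f n + sum f {n - int N..n - 1} = f (n - int N) + sum f {n - int N + 1..n}"
    by (metis (no_types, lifting) sum.insert finite_atLeastAtMost_int atLeastAtMost_iff
      zle_diff1_eq less_irrefl add1_zle_eq)
  then show ?thesis
    by (simp add: algebra_simps)
qed

section \<open>Dykstra's iterates and their normal vectors\<close>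

locale dykstra_sequence =
  fixes C :: "nat \<Rightarrow> 'a::{real_inner, complete_space} set"
    and N :: nat and x0 :: 'a and x q :: "int \<Rightarrow> 'a"
  assumes N1: "N \<ge> 1"
    and cl: "\<And>i. i \<in> {1..N} \<Longrightarrow> closed (C i)"
    and cv: "\<And>i. i \<in> {1..N} \<Longrightarrow> convex (C i)"
    and ne: "(\<Inter>i\<in>{1..N}. C i) \<noteq> {}"
    and dyk: "dykstra N C x0 x q"
begin

lemma dykstra_start: "x 0 = x0"
  and dykstra_q_zero: "- int N < k \<Longrightarrow> k \<le> 0 \<Longrightarrow> q k = 0"
  and dykstra_q: "n \<ge> 1 \<Longrightarrow> q n = x (n - 1) + q (n - int N) - x n"
  using dyk by (auto simp: dykstra_def)

lemma dykstra_index: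
  obtains j where "j \<in> {1..N}" "[int j = n] (mod int N)"
proof
  \<comment> \<open>Shifting by one before and after \<open>mod\<close> gives residues in
    \<open>{1..N}\<close>, so multiples of \<open>N\<close> get \<open>N\<close> instead of
    \<open>0\<close>.\<close>
  let ?j = "nat ((n - 1) mod int N + 1)"
  have ge: "0 \<le> (n - 1) mod int N" "(n - 1) mod int N < int N"
    using N1 by simp_all
  then show "?j \<in> {1..N}"
    by auto
  have "[(n - 1) mod int N + 1 = n - 1 + 1] (mod int N)"
    by (intro cong_add) auto
  then show "[int ?j = n] (mod int N)"
    using ge by simp
qed

lemma dykstra_x:
  assumes "n \<ge> 1" "j \<in> {1..N}" "[int j = n] (mod int N)"
  shows "x n = metric_proj (C j) (x (n - 1) + q (n - int N))"
  using assms dyk by (auto simp: dykstra_def)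

lemma dykstra_x_in:
  assumes "n \<ge> 1" "j \<in> {1..N}" "[int j = n] (mod int N)"
  shows "x n \<in> C j"
  unfolding dykstra_x[OF assms] using ne assms(2) by (intro metric_proj_in cv cl) auto

text \<open>For \<open>k \<ge> 1\<close>, \<open>q k\<close> is the residual of the projection
  defining \<open>x k\<close>; for earlier \<open>k\<close> it is zero, whatever \<open>x k\<close>
  is.\<close>

lemma dykstra_normal:
  assumes "- int N < k" "j \<in> {1..N}" "[int j = k] (mod int N)" "w \<in> C j"
  shows "(x k - w) \<bullet> q k \<ge> 0"
proof (cases "k \<le> 0")
  case True
  then show ?thesis
    using dykstra_q_zero assms(1) by simp
next
  case False
  then show ?thesis
    using metric_proj_dot[OF cv[OF assms(2)] cl[OF assms(2)] assms(4)] dykstra_q[of k]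
      dykstra_x[of k, OF _ assms(2,3)] by simp
qed

lemma dykstra_normal_Inter:
  assumes "- int N < k" "p \<in> (\<Inter>i\<in>{1..N}. C i)"
  shows "(x k - p) \<bullet> q k \<ge> 0"
  using dykstra_index[of k] dykstra_normal[OF assms(1)] assms(2) by (metis INT_E)

text \<open>Indices \<open>n\<close> and \<open>n - int N\<close> share one set, so
  \<open>x n\<close> may serve as the test point for the normal vector at
  \<open>n - int N\<close>.\<close>

lemma dykstra_lag_inner_nonneg:
  assumes "n \<ge> 1"
  shows "(x (n - int N) - x n) \<bullet> q (n - int N) \<ge> 0"
proof -
  obtain j where j: "j \<in> {1..N}" "[int j = n] (mod int N)"
    by (rule dykstra_index)
  moreover have "[int j = n - int N] (mod int N)"
    using j(2) by (simp add: cong_def)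
  ultimately show ?thesis
    using dykstra_normal[of "n - int N" j "x n"] dykstra_x_in[OF assms j] assms by simp
qed

section \<open>The energy and its monotonicity\<close>

definition dykstra_energy :: "'a \<Rightarrow> int \<Rightarrow> real" where
  "dykstra_energy p n = (norm (x n - p))\<^sup>2 + 2 * (\<Sum>k = n - int N + 1..n. (x k - p) \<bullet> q k)"

lemma dykstra_energy_step:
  assumes "n \<ge> 1"
  shows "dykstra_energy p n \<le> dykstra_energy p (n - 1)"
proof -
  have "dykstra_energy p (n - 1) - dykstra_energy p n
      = (norm (x (n - 1) - x n))\<^sup>2 + 2 * ((x (n - int N) - x n) \<bullet> q (n - int N))"
    \<comment> \<open>The two windows differ only in their end terms; inserting the recursion for
      \<open>q n\<close> leaves an identity between inner products.\<close>
    unfolding dykstra_energy_def sum_int_interval_shift[OF N1, of _ n]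
      dykstra_q[OF assms] power2_norm_eq_inner
    by (simp add: algebra_simps inner_commute)
  then show ?thesis
    using dykstra_lag_inner_nonneg[OF assms] by (smt (verit) zero_le_power2)
qed

lemma dykstra_energy_mono:
  "dykstra_energy p (int n + int l) \<le> dykstra_energy p (int n)"
proof (induction l)
  case (Suc l)
  have "dykstra_energy p (int n + int (Suc l)) \<le> dykstra_energy p (int n + int l)"
    using dykstra_energy_step[of "int n + int (Suc l)"] by (simp add: algebra_simps)
  with Suc show ?case
    by linarith
qed simp

lemma dykstra_norm_le_energy:
  assumes "p \<in> (\<Inter>i\<in>{1..N}. C i)"
  shows "(norm (x (int n) - p))\<^sup>2 \<le> dykstra_energy p (int n)"
  unfolding dykstra_energy_def
  using sum_nonneg[of "{int n - int N + 1..int n}" "\<lambda>k. (x k - p) \<bullet> q k"]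
    dykstra_normal_Inter[OF _ assms] by auto

lemma dykstra_norm_le_start:
  assumes "p \<in> (\<Inter>i\<in>{1..N}. C i)"
  shows "norm (x (int n) - p) \<le> norm (x0 - p)"
proof (rule power2_le_imp_le)
  have "(\<Sum>k = 0 - int N + 1..0. (x k - p) \<bullet> q k) = 0"
    using dykstra_q_zero by (intro sum.neutral) auto
  then have "dykstra_energy p 0 = (norm (x0 - p))\<^sup>2"
    by (simp only: dykstra_energy_def dykstra_start)
  then show "(norm (x (int n) - p))\<^sup>2 \<le> (norm (x0 - p))\<^sup>2"
    using dykstra_norm_le_energy[OF assms, of n] dykstra_energy_mono[of p 0 n, simplified] by linarith
qed simp

lemma dykstra_sum_q: "(\<Sum>k = int n - int N + 1..int n. q k) = x0 - x (int n)"
proof (induction n)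
  case 0
  have "(\<Sum>k = 0 - int N + 1..0. q k) = 0"
    using dykstra_q_zero by (intro sum.neutral) auto
  then show ?case
    by (simp add: dykstra_start)
next
  case (Suc n)
  have idx: "int (Suc n) - int N = int n - int N + 1" "int (Suc n) - 1 = int n"
    by simp_all
  have "(\<Sum>k = int (Suc n) - int N + 1..int (Suc n). q k)
      = (\<Sum>k = int n - int N + 1..int n. q k) + q (int (Suc n)) - q (int n - int N + 1)"
    using sum_int_interval_shift[OF N1, of q "int (Suc n)"] unfolding idx .
  moreover have "q (int (Suc n)) = x (int n) + q (int n - int N + 1) - x (int (Suc n))"
    using dykstra_q[of "int (Suc n)"] by (simp only: idx)
  ultimately show ?case
    by (simp only: Suc) simp
qed

lemma dykstra_energy_eq:
  "dykstra_energy p (int n) = (norm (x (int n) - p))\<^sup>2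
     + 2 * ((\<Sum>k = int n - int N + 1..int n. (x k - x (int n)) \<bullet> q k)
            + (x (int n) - p) \<bullet> (x0 - x (int n)))"
  \<comment> \<open>Termwise, \<open>x k - p\<close> splits as
    \<open>(x k - x n) + (x n - p)\<close>.\<close>
  unfolding dykstra_energy_def dykstra_sum_q[symmetric] inner_sum_right sum.distrib[symmetric]
  by (simp add: inner_diff_left)

end

theorem mainTheorem4:
  fixes C :: "nat \<Rightarrow> 'a::{real_inner, complete_space} set"
    and N b :: nat
    and x0 z :: 'a
    and x q :: "int \<Rightarrow> 'a"
  assumes "N \<ge> 1"
    and "\<And>i. i \<in> {1..N} \<Longrightarrow> closed (C i)"
    and "\<And>i. i \<in> {1..N} \<Longrightarrow> convex (C i)"
    and "(\<Inter>i\<in>{1..N}. C i) \<noteq> {}"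
    and "dykstra N C x0 x q"
    and "z \<in> (\<Inter>i\<in>{1..N}. C i)"
    and "b > 0"
    and "norm (z - x0) \<le> real b"
  shows "uniformly_locally_relativized_fejer (dykstra_S N x q) (\<lambda>a. a\<^sup>2) (\<lambda>a. a\<^sup>2)
           (\<lambda>n. x (int n)) (\<Inter>i\<in>{1..N}. C i) (\<lambda>r. 8 * b * (r + 1) - 1)"
  unfolding uniformly_locally_relativized_fejer_def
proof (intro ballI allI impI, elim conjE)
  interpret dykstra_sequence C N x0 x q
    using assms(1-5) by unfold_locales
  fix p r n l
  \<comment> \<open>This is \<open>1 / (\<rho> r + 1)\<close>, the bound in both hypotheses; the
    truncated subtraction in \<open>\<rho>\<close> is exact since \<open>b > 0\<close>.\<close>
  define \<epsilon> where "\<epsilon> = 1 / (8 * real b * (real r + 1))"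
  have "real (8 * b * (r + 1) - 1) + 1 = 8 * real b * (real r + 1)"
    using \<open>b > 0\<close> by (subst of_nat_diff) (auto simp: algebra_simps)
  then have \<epsilon>: "1 / (real (8 * b * (r + 1) - 1) + 1) = \<epsilon>"
    by (simp add: \<epsilon>_def)
  assume p: "p \<in> (\<Inter>i\<in>{1..N}. C i)"
    and "norm (x (int n) - p) < 1 / (real (8 * b * (r + 1) - 1) + 1)"
    and "dykstra_S N x q n (8 * b * (r + 1) - 1)"
  then have near: "norm (x (int n) - p) < \<epsilon>"
    and S: "(\<Sum>k = int n - int N + 1..int n. (x k - x (int n)) \<bullet> q k) < \<epsilon>"
    unfolding dykstra_S_def \<epsilon> by auto
  \<comment> \<open>Both \<open>x0\<close> and \<open>x n\<close> lie within \<open>b\<close> of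
    \<open>z\<close>, hence the factor \<open>2 * b\<close>.\<close>
  have "norm (x0 - x (int n)) \<le> norm (x0 - z) + norm (x (int n) - z)"
    using norm_triangle_ineq4[of "x0 - z" "x (int n) - z"] by simp
  also have "\<dots> \<le> 2 * real b"
    using dykstra_norm_le_start[OF assms(6), of n] assms(8) by (simp add: norm_minus_commute)
  finally have "norm (x (int n) - p) * norm (x0 - x (int n)) \<le> \<epsilon> * (2 * real b)"
    using near by (intro mult_mono) (auto simp: \<epsilon>_def)
  then have inner: "(x (int n) - p) \<bullet> (x0 - x (int n)) \<le> \<epsilon> * (2 * real b)"
    using norm_cauchy_schwarz order_trans by blast
  \<comment> \<open>A positive natural \<open>b\<close> is at least 1, so the total error is at most
    \<open>6 * \<epsilon> * b\<close>, below
    \<open>8 * \<epsilon> * b = 1 / (r + 1)\<close>.\<close>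
  have "\<epsilon> > 0" "\<epsilon> \<le> \<epsilon> * real b"
    using \<open>b > 0\<close> mult_left_mono[of 1 "real b" \<epsilon>] by (simp_all add: \<epsilon>_def)
  then have "2 * (\<epsilon> + \<epsilon> * (2 * real b)) \<le> 8 * (\<epsilon> * real b)"
    by (simp add: mult.left_commute[of \<epsilon> 2])
  also have "\<dots> = 1 / (real r + 1)"
    using \<open>b > 0\<close> by (simp add: \<epsilon>_def divide_simps)
  finally have bound: "2 * (\<epsilon> + \<epsilon> * (2 * real b)) \<le> 1 / (real r + 1)" .
  have "(norm (x (int (n + l)) - p))\<^sup>2 \<le> dykstra_energy p (int n)"
    using dykstra_norm_le_energy[OF p, of "n + l"] dykstra_energy_mono[of p n l] by simp
  also have "\<dots> \<le> (norm (x (int n) - p))\<^sup>2 + 2 * (\<epsilon> + \<epsilon> * (2 * real b))"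
    unfolding dykstra_energy_eq using S inner
    by (intro add_left_mono mult_left_mono add_mono less_imp_le) simp_all
  also have "\<dots> \<le> (norm (x (int n) - p))\<^sup>2 + 1 / (real r + 1)"
    using bound by (rule add_left_mono)
  finally show "(norm (x (int (n + l)) - p))\<^sup>2 \<le> (norm (x (int n) - p))\<^sup>2 + 1 / (real r + 1)" .
qed

end
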